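(* Let $\Lambda$ be a normal modal logic over $\mathcal L_\lozenge$ that is complete for a class $\Omega$ of derivative spaces (every formula of $\mathcal L_\lozenge$ valid on all members of $\Omega$ belongs to $\Lambda$). If $\Omega$ is closed under sums, then $\Lambda\mathbf H$ is complete for the class of invertible systems based on $\Omega$; that is, every formula of $\mathcal L^\circ_\lozenge$ valid on all invertible dynamic derivative systems $\langle X,\rho,f\rangle$ with $\langle X,\rho\rangle\in\Omega$ belongs to $\Lambda\mathbf H$.
   Context: $\mathcal L^\circ_\lozenge$ is the language $\varphi ::= p \mid \varphi\wedge\varphi \mid \neg\varphi \mid \lozenge\varphi \mid \bigcirc\varphi$, with $p$ in a non-empty set $\mathsf{PV}$ of variables; $\square:=\neg\lozenge\neg$; $\mathcal L_\lozenge$ is its $\bigcirc$-free fragment. A normal modal logic over $\mathcal L_\lozenge$ is a set of $\mathcal L_\lozenge$-formulas containing all propositional tautologies and all instances of $\square(\varphi\to\psi)\to(\square\varphi\to\square\psi)$, and closed under substitution, modus ponens and necessitation for $\square$. $\Lambda\mathbf H$ is the least set of $\mathcal L^\circ_\lozenge$-formulas containing all propositional tautologies, all $\mathcal L^\circ_\lozenge$-substitution instances of members of $\Lambda$, all instances of $\neg\bigcirc\varphi\leftrightarrow\bigcirc\neg\varphi$, of $\bigcirc(\varphi\wedge\psi)\leftrightarrow\bigcirc\varphi\wedge\bigcirc\psi$ and of H: $\square\bigcirc\varphi\leftrightarrow\bigcirc\square\varphi$, and closed under modus ponens and necessitation for $\square$ and for $\bigcirc$. A derivative space is a pair $\langle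 X,\rho\rangle$ with $\rho\colon\wp(X)\to\wp(X)$ such that $\rho(\varnothing)=\varnothing$, $\rho(A\cup B)=\rho(A)\cup\rho(B)$, $\rho\rho(A)\subseteq A\cup\rho(A)$. An invertible dynamic derivative system is $\langle X,\rho,f\rangle$ with $\langle X,\rho\rangle$ a derivative space and $f\colon X\to X$ a homeomorphism, i.e. a bijection with $\rho f^{-1}(A)=f^{-1}\rho(A)$ for all $A\subseteq X$. Semantics for a valuation $\nu\colon\mathsf{PV}\to\wp(X)$: $\|p\|=\nu(p)$, Boolean connectives as usual, $\|\lozenge\varphi\|=\rho(\|\varphi\|)$, $\|\bigcirc\varphi\|=f^{-1}(\|\varphi\|)$ (the last clause not needed for $\mathcal L_\lozenge$ on a derivative space). A formula is valid on a space or system if $\|\varphi\|=X$ for all valuations. The sum of derivative spaces $\langle X,\rho_X\rangle$, $\langle Y,\rho_Y\rangle$ is $\langle X\oplus Y,\rho_X\oplus\rho_Y\rangle$, with $X\oplus Y$ the disjoint union and $(\rho_X\oplus\rho_Y)(A)=\rho_X(A\cap X)\cup\rho_Y(A\cap Y)$. $\Omega$ is closed under sums if $\mathfrak A,\mathfrak B\in\Omega$ implies $\mathfrak A\oplus\mathfrak B\in\Omega$.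
   Formalization: The set PV of propositional variables is assumed to be infinite instead of merely non-empty; for every finite PV the claim fails (take finite sums of clusters with at most 2^n points, where n is the number of variables). *)

theory Defs imports Main begin

text \<open>The non-empty set of propositional variables is the type \<open>'v\<close>. The transfer of
  completeness needs \<open>'v\<close> to be infinite: with \<open>n\<close> variables, \<open>L_dia\<close> cannot tell a universal cluster
  with \<open>2 ^ n\<close> points from a larger one, whereas iterating \<open>Next\<close> provides further, independent
  atoms that can.\<close>

datatype 'v fm =
    Var 'v
  | And "'v fm" "'v fm"
  | Neg "'v fm"
  | Dia "'v fm"
  | Next "'v fm"

abbreviation Imp :: "'v fm \<Rightarrow> 'v fm \<Rightarrow> 'v fm" where
  "Imp \<phi> \<psi> \<equiv> Neg (And \<phi> (Neg \<psi>))"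

abbreviation Iff :: "'v fm \<Rightarrow> 'v fm \<Rightarrow> 'v fm" where
  "Iff \<phi> \<psi> \<equiv> And (Imp \<phi> \<psi>) (Imp \<psi> \<phi>)"

abbreviation Box :: "'v fm \<Rightarrow> 'v fm" where
  "Box \<phi> \<equiv> Neg (Dia (Neg \<phi>))"

primrec next_free :: "'v fm \<Rightarrow> bool" where
  "next_free (Var p) = True"
| "next_free (And \<phi> \<psi>) = (next_free \<phi> \<and> next_free \<psi>)"
| "next_free (Neg \<phi>) = next_free \<phi>"
| "next_free (Dia \<phi>) = next_free \<phi>"
| "next_free (Next \<phi>) = False"

definition L_dia :: "'v fm set" where
  "L_dia = {\<phi>. next_free \<phi>}"

primrec subst :: "('v \<Rightarrow> 'v fm) \<Rightarrow> 'v fm \<Rightarrow> 'v fm" where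
  "subst \<sigma> (Var p) = \<sigma> p"
| "subst \<sigma> (And \<phi> \<psi>) = And (subst \<sigma> \<phi>) (subst \<sigma> \<psi>)"
| "subst \<sigma> (Neg \<phi>) = Neg (subst \<sigma> \<phi>)"
| "subst \<sigma> (Dia \<phi>) = Dia (subst \<sigma> \<phi>)"
| "subst \<sigma> (Next \<phi>) = Next (subst \<sigma> \<phi>)"

text \<open>Propositional evaluation: variables and formulas whose main operator is modal are
  independent atoms, so tautologies include the substitution instances of classical ones.\<close>

primrec prop_eval :: "('v fm \<Rightarrow> bool) \<Rightarrow> 'v fm \<Rightarrow> bool" where
  "prop_eval v (Var p) = v (Var p)"
| "prop_eval v (And \<phi> \<psi>) = (prop_eval v \<phi> \<and> prop_eval v \<psi>)"
| "prop_eval v (Neg \<phi>) = (\<not> prop_eval v \<phi>)"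
| "prop_eval v (Dia \<phi>) = v (Dia \<phi>)"
| "prop_eval v (Next \<phi>) = v (Next \<phi>)"

definition tautology :: "'v fm \<Rightarrow> bool" where
  "tautology \<phi> \<longleftrightarrow> (\<forall>v. prop_eval v \<phi>)"

definition normal_logic :: "'v fm set \<Rightarrow> bool" where
  "normal_logic \<Lambda> \<longleftrightarrow>
     \<Lambda> \<subseteq> L_dia \<and>
     (\<forall>\<phi>\<in>L_dia. tautology \<phi> \<longrightarrow> \<phi> \<in> \<Lambda>) \<and>
     (\<forall>\<phi>\<in>L_dia. \<forall>\<psi>\<in>L_dia. Imp (Box (Imp \<phi> \<psi>)) (Imp (Box \<phi>) (Box \<psi>)) \<in> \<Lambda>) \<and>
     (\<forall>\<sigma> \<phi>. range \<sigma> \<subseteq> L_dia \<longrightarrow> \<phi> \<in> \<Lambda> \<longrightarrow> subst \<sigma> \<phi> \<in> \<Lambda>) \<and>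
     (\<forall>\<phi> \<psi>. \<phi> \<in> \<Lambda> \<longrightarrow> Imp \<phi> \<psi> \<in> \<Lambda> \<longrightarrow> \<psi> \<in> \<Lambda>) \<and>
     (\<forall>\<phi>\<in>\<Lambda>. Box \<phi> \<in> \<Lambda>)"

inductive_set logic_H :: "'v fm set \<Rightarrow> 'v fm set" for \<Lambda> :: "'v fm set" where
  taut: "tautology \<phi> \<Longrightarrow> \<phi> \<in> logic_H \<Lambda>"
| inst: "\<phi> \<in> \<Lambda> \<Longrightarrow> subst \<sigma> \<phi> \<in> logic_H \<Lambda>"
| next_neg: "Iff (Neg (Next \<phi>)) (Next (Neg \<phi>)) \<in> logic_H \<Lambda>"
| next_and: "Iff (Next (And \<phi> \<psi>)) (And (Next \<phi>) (Next \<psi>)) \<in> logic_H \<Lambda>"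
| H: "Iff (Box (Next \<phi>)) (Next (Box \<phi>)) \<in> logic_H \<Lambda>"
| mp: "\<phi> \<in> logic_H \<Lambda> \<Longrightarrow> Imp \<phi> \<psi> \<in> logic_H \<Lambda> \<Longrightarrow> \<psi> \<in> logic_H \<Lambda>"
| nec_box: "\<phi> \<in> logic_H \<Lambda> \<Longrightarrow> Box \<phi> \<in> logic_H \<Lambda>"
| nec_next: "\<phi> \<in> logic_H \<Lambda> \<Longrightarrow> Next \<phi> \<in> logic_H \<Lambda>"

text \<open>Spaces have an explicit (possibly empty) carrier \<open>X\<close>. The operator \<open>\<rho>\<close> is a total function on
  \<open>'a set\<close>, but only its values on subsets of \<open>X\<close> are constrained or used.\<close>

type_synonym 'a space = "'a set \<times> ('a set \<Rightarrow> 'a set)"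

locale derivative_space =
  fixes X :: "'a set" and \<rho> :: "'a set \<Rightarrow> 'a set"
  assumes closed: "A \<subseteq> X \<Longrightarrow> \<rho> A \<subseteq> X"
    and empty: "\<rho> {} = {}"
    and union: "A \<subseteq> X \<Longrightarrow> B \<subseteq> X \<Longrightarrow> \<rho> (A \<union> B) = \<rho> A \<union> \<rho> B"
    and weak_trans: "A \<subseteq> X \<Longrightarrow> \<rho> (\<rho> A) \<subseteq> A \<union> \<rho> A"

locale invertible_system = derivative_space X \<rho>
  for X :: "'a set" and \<rho> :: "'a set \<Rightarrow> 'a set" +
  fixes f :: "'a \<Rightarrow> 'a"
  assumes bij: "bij_betw f X X"
    and homeo: "A \<subseteq> X \<Longrightarrow> \<rho> (f -` A \<inter> X) = f -` \<rho> A \<inter> X"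

primrec sem :: "'a set \<Rightarrow> ('a set \<Rightarrow> 'a set) \<Rightarrow> ('a \<Rightarrow> 'a) \<Rightarrow> ('v \<Rightarrow> 'a set) \<Rightarrow> 'v fm \<Rightarrow> 'a set" where
  "sem X \<rho> f \<nu> (Var p) = \<nu> p"
| "sem X \<rho> f \<nu> (And \<phi> \<psi>) = sem X \<rho> f \<nu> \<phi> \<inter> sem X \<rho> f \<nu> \<psi>"
| "sem X \<rho> f \<nu> (Neg \<phi>) = X - sem X \<rho> f \<nu> \<phi>"
| "sem X \<rho> f \<nu> (Dia \<phi>) = \<rho> (sem X \<rho> f \<nu> \<phi>)"
| "sem X \<rho> f \<nu> (Next \<phi>) = f -` sem X \<rho> f \<nu> \<phi> \<inter> X"

definition valid_system :: "'a set \<Rightarrow> ('a set \<Rightarrow> 'a set) \<Rightarrow> ('a \<Rightarrow> 'a) \<Rightarrow> 'v fm \<Rightarrow> bool" where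
  "valid_system X \<rho> f \<phi> \<longleftrightarrow> (\<forall>\<nu>. (\<forall>p. \<nu> p \<subseteq> X) \<longrightarrow> sem X \<rho> f \<nu> \<phi> = X)"

text \<open>On a bare space only formulas in \<open>L_dia\<close> are evaluated; the map is then irrelevant, and \<open>id\<close> is
  a placeholder.\<close>

lemma sem_next_free: "next_free \<phi> \<Longrightarrow> sem X \<rho> f \<nu> \<phi> = sem X \<rho> g \<nu> \<phi>"
  by (induction \<phi>) auto

definition valid_space :: "'a set \<Rightarrow> ('a set \<Rightarrow> 'a set) \<Rightarrow> 'v fm \<Rightarrow> bool" where
  "valid_space X \<rho> \<phi> \<longleftrightarrow> valid_system X \<rho> id \<phi>"

definition space_sum :: "'a space \<Rightarrow> 'b space \<Rightarrow> ('a + 'b) space" where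
  "space_sum S T =
     (fst S <+> fst T,
      \<lambda>A. snd S (Inl -` A \<inter> fst S) <+> snd T (Inr -` A \<inter> fst T))"

definition space_iso :: "'a space \<Rightarrow> 'b space \<Rightarrow> bool" where
  "space_iso S T \<longleftrightarrow>
     (\<exists>h. bij_betw h (fst S) (fst T) \<and> (\<forall>A \<subseteq> fst S. h ` snd S A = snd T (h ` A)))"

text \<open>All members of a class have points in one type \<open>'a\<close>, whereas the disjoint union of two of them
  has points in \<open>'a + 'a\<close>; hence the sum is required to be in the class up to isomorphism.\<close>

definition closed_under_sums :: "'a space set \<Rightarrow> bool" where
  "closed_under_sums \<Omega> \<longleftrightarrow> (\<forall>S\<in>\<Omega>. \<forall>T\<in>\<Omega>. \<exists>U\<in>\<Omega>. space_iso U (space_sum S T))"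

definition complete_for_spaces :: "'v fm set \<Rightarrow> 'a space set \<Rightarrow> bool" where
  "complete_for_spaces \<Lambda> \<Omega> \<longleftrightarrow>
     (\<forall>\<phi>\<in>L_dia. (\<forall>(X, \<rho>)\<in>\<Omega>. valid_space X \<rho> \<phi>) \<longrightarrow> \<phi> \<in> \<Lambda>)"

definition invertible_systems_on ::
    "'a space set \<Rightarrow> ('a set \<times> ('a set \<Rightarrow> 'a set) \<times> ('a \<Rightarrow> 'a)) set" where
  "invertible_systems_on \<Omega> = {(X, \<rho>, f). (X, \<rho>) \<in> \<Omega> \<and> invertible_system X \<rho> f}"

definition complete_for_systems ::
    "'v fm set \<Rightarrow> ('a set \<times> ('a set \<Rightarrow> 'a set) \<times> ('a \<Rightarrow> 'a)) set \<Rightarrow> bool" where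
  "complete_for_systems L \<S> \<longleftrightarrow>
     (\<forall>\<phi>. (\<forall>(X, \<rho>, f)\<in>\<S>. valid_system X \<rho> f \<phi>) \<longrightarrow> \<phi> \<in> L)"

end

theory Submission imports Defs begin

text \<open>Pushing \<open>Next\<close> down to the variables turns \<open>\<phi>\<close> into a \<open>Next\<close>-free formula over atoms
  \<open>Next\<^sup>i p\<close>. Reading these atoms as fresh variables \<open>e (p, i)\<close> gives a formula of \<open>L_dia\<close>, which is
  refuted on some \<open>X\<close> in \<open>\<Omega>\<close> whenever \<open>\<phi>\<close> is not a theorem. Now take the sum of \<open>n\<close> copies of \<open>X\<close>, with
  \<open>n\<close> larger than the nesting of \<open>Next\<close>, let \<open>f\<close> permute the copies cyclically, and let \<open>p\<close> hold on the
  \<open>i\<close>-th copy where \<open>e (p, i)\<close> holds on \<open>X\<close>. Then \<open>\<phi>\<close> is refuted on the \<open>0\<close>-th copy.\<close>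

section \<open>Derivations\<close>

lemma logic_H_taut_mp:
  assumes "a \<in> logic_H \<Lambda>" "tautology (Imp a b)"
  shows "b \<in> logic_H \<Lambda>"
  using assms(1) logic_H.taut[OF assms(2)] by (rule logic_H.mp)

lemma logic_H_taut_mp2:
  assumes "a \<in> logic_H \<Lambda>" "b \<in> logic_H \<Lambda>" "tautology (Imp a (Imp b c))"
  shows "c \<in> logic_H \<Lambda>"
  using assms(2) logic_H_taut_mp[OF assms(1,3)] by (rule logic_H.mp)

lemma logic_H_taut_mp3:
  assumes "a \<in> logic_H \<Lambda>" "b \<in> logic_H \<Lambda>" "c \<in> logic_H \<Lambda>"
    and "tautology (Imp a (Imp b (Imp c d)))"
  shows "d \<in> logic_H \<Lambda>"
  using assms(3) logic_H_taut_mp2[OF assms(1,2,4)] by (rule logic_H.mp)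

lemma logic_H_iff_refl: "Iff a a \<in> logic_H \<Lambda>"
  by (rule logic_H.taut) (simp add: tautology_def)

lemma logic_H_iff_sym: "Iff a b \<in> logic_H \<Lambda> \<Longrightarrow> Iff b a \<in> logic_H \<Lambda>"
  by (erule logic_H_taut_mp) (auto simp: tautology_def)

lemma logic_H_iff_trans:
  "Iff a b \<in> logic_H \<Lambda> \<Longrightarrow> Iff b c \<in> logic_H \<Lambda> \<Longrightarrow> Iff a c \<in> logic_H \<Lambda>"
  by (erule logic_H_taut_mp2, assumption) (auto simp: tautology_def)

lemma logic_H_iffD1: "Iff a b \<in> logic_H \<Lambda> \<Longrightarrow> Imp a b \<in> logic_H \<Lambda>"
  by (erule logic_H_taut_mp) (auto simp: tautology_def)

lemma logic_H_iffD2: "Iff a b \<in> logic_H \<Lambda> \<Longrightarrow> Imp b a \<in> logic_H \<Lambda>"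
  by (erule logic_H_taut_mp) (auto simp: tautology_def)

lemma logic_H_iffI:
  "Imp a b \<in> logic_H \<Lambda> \<Longrightarrow> Imp b a \<in> logic_H \<Lambda> \<Longrightarrow> Iff a b \<in> logic_H \<Lambda>"
  by (erule logic_H_taut_mp2, assumption) (auto simp: tautology_def)

lemma logic_H_neg_cong: "Iff a b \<in> logic_H \<Lambda> \<Longrightarrow> Iff (Neg a) (Neg b) \<in> logic_H \<Lambda>"
  by (erule logic_H_taut_mp) (auto simp: tautology_def)

lemma logic_H_and_cong:
  "Iff a b \<in> logic_H \<Lambda> \<Longrightarrow> Iff c d \<in> logic_H \<Lambda> \<Longrightarrow> Iff (And a c) (And b d) \<in> logic_H \<Lambda>"
  by (erule logic_H_taut_mp2, assumption) (auto simp: tautology_def)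

text \<open>\<open>Imp a b\<close> unfolds to \<open>Neg (And a (Neg b))\<close>, so commutation of
  \<open>Next\<close> with \<open>Neg\<close> and \<open>And\<close> already yields distribution of
  \<open>Next\<close> over implication.\<close>

lemma logic_H_next_mono:
  assumes "Imp a b \<in> logic_H \<Lambda>"
  shows "Imp (Next a) (Next b) \<in> logic_H \<Lambda>"
proof -
  have "Imp (Next (Imp a b)) (Imp (Next a) (Next b)) \<in> logic_H \<Lambda>"
    by (rule logic_H_taut_mp3[OF logic_H.next_neg[of "And a (Neg b)"]
          logic_H.next_and[of a "Neg b"] logic_H.next_neg[of b]]) (auto simp: tautology_def)
  then show ?thesis
    by (rule logic_H.mp[OF logic_H.nec_next[OF assms]])
qed

lemma logic_H_next_cong:
  "Iff a b \<in> logic_H \<Lambda> \<Longrightarrow> Iff (Next a) (Next b) \<in> logic_H \<Lambda>"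
  by (rule logic_H_iffI[OF logic_H_next_mono[OF logic_H_iffD1]
        logic_H_next_mono[OF logic_H_iffD2]])

text \<open>\<open>a\<close> is covered by \<open>b\<close> and the difference of \<open>a\<close>
  and \<open>b\<close>; the premise says that a point avoids \<open>\<rho>\<close> of this
  difference.\<close>

lemma valid_space_dia_mono:
  assumes "derivative_space X \<rho>"
  shows "valid_space X \<rho> (Imp (Box (Imp a b)) (Imp (Dia a) (Dia b)))"
  unfolding valid_space_def valid_system_def
proof (intro allI impI)
  interpret derivative_space X \<rho> by fact
  fix \<nu> :: "'b \<Rightarrow> 'a set"
  assume \<nu>: "\<forall>p. \<nu> p \<subseteq> X"
  let ?S = "sem X \<rho> id \<nu>"
  have sub: "?S \<psi> \<subseteq> X" for \<psi>
    using \<nu> by (induction \<psi>) (auto dest: closed)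
  \<comment> \<open>This double complement comes from the \<open>Neg\<close> in \<open>Box\<close>
    meeting the outer \<open>Neg\<close> of \<open>Imp a b\<close>.\<close>
  have neg: "X - (X - ?S a \<inter> (X - ?S b)) = ?S a \<inter> (X - ?S b)"
    using sub by blast
  \<comment> \<open>The inclusion is written as an equation between unions, so that additivity of
    \<open>\<rho>\<close> delivers monotonicity.\<close>
  have "?S a \<union> (?S b \<union> ?S a \<inter> (X - ?S b)) = ?S b \<union> ?S a \<inter> (X - ?S b)"
    using sub by blast
  then have "\<rho> (?S a) \<subseteq> \<rho> (?S b) \<union> \<rho> (?S a \<inter> (X - ?S b))"
    using union[of "?S a" "?S b \<union> ?S a \<inter> (X - ?S b)"] union[of "?S b" "?S a \<inter> (X - ?S b)"] sub
    by (metis Un_subset_iff inf.coboundedI1 sup.cobounded1)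
  then show "?S (Imp (Box (Imp a b)) (Imp (Dia a) (Dia b))) = X"
    by (auto simp: neg)
qed

lemma complete_for_spacesD:
  assumes "complete_for_spaces \<Lambda> \<Omega>" "next_free \<phi>"
    and "\<And>X \<rho>. (X, \<rho>) \<in> \<Omega> \<Longrightarrow> valid_space X \<rho> \<phi>"
  shows "\<phi> \<in> \<Lambda>"
  using assms unfolding complete_for_spaces_def L_dia_def by blast

text \<open>Congruence of \<open>Dia\<close> does not follow from the axioms of a normal logic as they are stated for
  the defined \<open>Box\<close>: nothing there relates \<open>Dia p\<close> to \<open>Dia (Neg (Neg p))\<close>. Hence the appeal to
  completeness.\<close>

lemma logic_H_dia_cong:
  fixes \<Lambda> :: "'v fm set" and \<Omega> :: "'a space set"
  assumes inf: "infinite (UNIV :: 'v set)"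
    and der: "\<forall>(X, \<rho>)\<in>\<Omega>. derivative_space X \<rho>"
    and compl: "complete_for_spaces \<Lambda> \<Omega>"
    and iff: "Iff a b \<in> logic_H \<Lambda>"
  shows "Iff (Dia a) (Dia b) \<in> logic_H \<Lambda>"
proof -
  \<comment> \<open>With two distinct variables, a single substitution can send them to unrelated
    formulas \<open>c\<close> and \<open>d\<close>.\<close>
  obtain p q :: 'v where "p \<noteq> q"
    using ex_new_if_finite[OF inf, of "{undefined}"] by auto
  have "Imp (Box (Imp (Var p) (Var q))) (Imp (Dia (Var p)) (Dia (Var q))) \<in> \<Lambda>"
    using der by (intro complete_for_spacesD[OF compl] valid_space_dia_mono) auto
  from logic_H.inst[OF this, of "\<lambda>r. if r = p then _ else _"] \<open>p \<noteq> q\<close>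
  have ax: "Imp (Box (Imp c d)) (Imp (Dia c) (Dia d)) \<in> logic_H \<Lambda>" for c d
    by simp
  have "Imp (Dia c) (Dia d) \<in> logic_H \<Lambda>" if "Imp c d \<in> logic_H \<Lambda>" for c d
    using that by (rule logic_H.mp[OF logic_H.nec_box ax])
  from logic_H_iffI[OF this[OF logic_H_iffD1[OF iff]] this[OF logic_H_iffD2[OF iff]]]
  show ?thesis .
qed

section \<open>Pushing \<open>Next\<close> to the variables\<close>

text \<open>The index \<open>i\<close> counts the occurrences of \<open>Next\<close> passed so far:
  the result stands for \<open>(Next ^^ i) \<phi>\<close>. Coding pairs by \<open>e\<close> keeps it
  over the variables of \<open>\<Lambda>\<close>.\<close>

primrec push_next :: "('v \<times> nat \<Rightarrow> 'v) \<Rightarrow> nat \<Rightarrow> 'v fm \<Rightarrow> 'v fm" where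
  "push_next e i (Var p) = Var (e (p, i))"
| "push_next e i (And \<phi> \<psi>) = And (push_next e i \<phi>) (push_next e i \<psi>)"
| "push_next e i (Neg \<phi>) = Neg (push_next e i \<phi>)"
| "push_next e i (Dia \<phi>) = Dia (push_next e i \<phi>)"
| "push_next e i (Next \<phi>) = push_next e (Suc i) \<phi>"

lemma next_free_push_next: "next_free (push_next e i \<phi>)"
  by (induction \<phi> arbitrary: i) auto

lemma logic_H_nexts_and:
  "Iff ((Next ^^ i) (And a b)) (And ((Next ^^ i) a) ((Next ^^ i) b)) \<in> logic_H \<Lambda>"
proof (induction i)
  case 0
  show ?case by (simp add: logic_H_iff_refl)
next
  case (Suc i)
  show ?case
    using logic_H_iff_trans[OF logic_H_next_cong[OF Suc.IH] logic_H.next_and] by simp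
qed

lemma logic_H_nexts_neg: "Iff ((Next ^^ i) (Neg a)) (Neg ((Next ^^ i) a)) \<in> logic_H \<Lambda>"
proof (induction i)
  case 0
  show ?case by (simp add: logic_H_iff_refl)
next
  case (Suc i)
  show ?case
    using logic_H_iff_trans[OF logic_H_next_cong[OF Suc.IH] logic_H_iff_sym[OF logic_H.next_neg]] by simp
qed

text \<open>Axiom \<open>H\<close> at \<open>Neg a\<close> gives this up to double negations. Those
  under \<open>Dia\<close> are removed by \<open>cong\<close>, the others propositionally with
  \<open>next_neg\<close>.\<close>

lemma logic_H_next_dia:
  assumes cong: "\<And>a b. Iff a b \<in> logic_H \<Lambda> \<Longrightarrow> Iff (Dia a) (Dia b) \<in> logic_H \<Lambda>"
  shows "Iff (Next (Dia a)) (Dia (Next a)) \<in> logic_H \<Lambda>"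
proof -
  have "Iff (Neg (Next (Neg a))) (Next a) \<in> logic_H \<Lambda>"
    by (rule logic_H_taut_mp[OF logic_H.next_neg[of a]]) (auto simp: tautology_def)
  then have "Iff (Dia (Neg (Next (Neg a)))) (Dia (Next a)) \<in> logic_H \<Lambda>"
    by (rule cong)
  moreover have "Iff (Next (Dia (Neg (Neg a)))) (Next (Dia a)) \<in> logic_H \<Lambda>"
    by (rule logic_H_next_cong[OF cong[OF logic_H.taut]]) (auto simp: tautology_def)
  moreover have "Iff (Next (Dia (Neg (Neg a)))) (Dia (Neg (Next (Neg a)))) \<in> logic_H \<Lambda>"
    by (rule logic_H_taut_mp2[OF logic_H.H[of "Neg a"] logic_H.next_neg[of "Dia (Neg (Neg a))"]])
      (auto simp: tautology_def)
  ultimately show ?thesis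
    by (rule logic_H_taut_mp3) (auto simp: tautology_def)
qed

lemma logic_H_nexts_dia:
  assumes cong: "\<And>a b. Iff a b \<in> logic_H \<Lambda> \<Longrightarrow> Iff (Dia a) (Dia b) \<in> logic_H \<Lambda>"
  shows "Iff ((Next ^^ i) (Dia a)) (Dia ((Next ^^ i) a)) \<in> logic_H \<Lambda>"
proof (induction i)
  case 0
  show ?case by (simp add: logic_H_iff_refl)
next
  case (Suc i)
  show ?case
    using logic_H_iff_trans[OF logic_H_next_cong[OF Suc.IH] logic_H_next_dia[OF cong]] by simp
qed

text \<open>The substitution \<open>\<sigma>\<close> decodes the variables \<open>e (p, i)\<close>.
  Each connective is crossed by its commutation law; a \<open>Next\<close> is absorbed into the
  index, hence the induction for all \<open>i\<close>.\<close>

lemma logic_H_push_next: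
  assumes cong: "\<And>a b. Iff a b \<in> logic_H \<Lambda> \<Longrightarrow> Iff (Dia a) (Dia b) \<in> logic_H \<Lambda>"
    and \<sigma>: "\<And>p i. \<sigma> (e (p, i)) = (Next ^^ i) (Var p)"
  shows "Iff ((Next ^^ i) \<phi>) (subst \<sigma> (push_next e i \<phi>)) \<in> logic_H \<Lambda>"
proof (induction \<phi> arbitrary: i)
  case (Var p)
  show ?case by (simp add: \<sigma> logic_H_iff_refl)
next
  case (And \<phi> \<psi>)
  show ?case
    using logic_H_iff_trans[OF logic_H_nexts_and logic_H_and_cong[OF And.IH]] by simp
next
  case (Neg \<phi>)
  show ?case
    using logic_H_iff_trans[OF logic_H_nexts_neg logic_H_neg_cong[OF Neg.IH]] by simp
next
  case (Dia \<phi>)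
  show ?case
    using logic_H_iff_trans[OF logic_H_nexts_dia[OF cong] cong[OF Dia.IH]] by simp
next
  case (Next \<phi>)
  show ?case
    using Next.IH[of "Suc i"] by (simp add: funpow_swap1)
qed

section \<open>Powers of a space\<close>

text \<open>\<open>g\<close> exhibits \<open>(Y, \<tau>)\<close> as the sum of \<open>n\<close> copies of \<open>(X, \<rho>)\<close>.\<close>

definition space_power ::
    "nat \<Rightarrow> 'a set \<Rightarrow> ('a set \<Rightarrow> 'a set) \<Rightarrow> 'b set \<Rightarrow> ('b set \<Rightarrow> 'b set) \<Rightarrow> ('a \<times> nat \<Rightarrow> 'b) \<Rightarrow> bool"
  where
  "space_power n X \<rho> Y \<tau> g \<longleftrightarrow> bij_betw g (X \<times> {..<n}) Y \<and>
     (\<forall>A\<subseteq>Y. \<forall>x\<in>X. \<forall>i<n. g (x, i) \<in> \<tau> A \<longleftrightarrow> x \<in> \<rho> {z\<in>X. g (z, i) \<in> A})"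

text \<open>With \<open>k\<close> the inverse of the isomorphism, images under it become membership
  conditions, one for each summand. This form suits the induction on the number of copies.\<close>

lemma space_iso_sum_pointwise:
  assumes iso: "space_iso (Z, \<tau>) (space_sum (Y, \<sigma>) (X, \<rho>))"
    and Z: "derivative_space Z \<tau>"
  obtains k where "bij_betw k (Y <+> X) Z"
    and "\<forall>A\<subseteq>Z. \<forall>y\<in>Y. k (Inl y) \<in> \<tau> A \<longleftrightarrow> y \<in> \<sigma> {y\<in>Y. k (Inl y) \<in> A}"
    and "\<forall>A\<subseteq>Z. \<forall>x\<in>X. k (Inr x) \<in> \<tau> A \<longleftrightarrow> x \<in> \<rho> {x\<in>X. k (Inr x) \<in> A}"
proof -
  obtain h where h: "bij_betw h Z (Y <+> X)"
    and im: "\<And>A. A \<subseteq> Z \<Longrightarrow>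
      h ` \<tau> A = \<sigma> (Inl -` (h ` A) \<inter> Y) <+> \<rho> (Inr -` (h ` A) \<inter> X)"
    using iso by (auto simp: space_iso_def space_sum_def)
  let ?k = "inv_into Z h"
  have k: "bij_betw ?k (Y <+> X) Z"
    using h by (rule bij_betw_inv_into)
  have mem: "w \<in> h ` A \<longleftrightarrow> ?k w \<in> A" if "A \<subseteq> Z" "w \<in> Y <+> X" for A w
  proof
    assume "w \<in> h ` A"
    then show "?k w \<in> A"
      using bij_betw_inv_into_left[OF h] \<open>A \<subseteq> Z\<close> by auto
  next
    assume "?k w \<in> A"
    then show "w \<in> h ` A"
      using bij_betw_inv_into_right[OF h that(2)] by (metis imageI)
  qed
  have meml: "Inl y \<in> h ` A \<longleftrightarrow> ?k (Inl y) \<in> A" if "A \<subseteq> Z" "y \<in> Y" for A y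
    using that by (intro mem InlI)
  have memr: "Inr x \<in> h ` A \<longleftrightarrow> ?k (Inr x) \<in> A" if "A \<subseteq> Z" "x \<in> X" for A x
    using that by (intro mem InrI)
  \<comment> \<open>Membership is transferred for \<open>\<tau> A\<close> as well as for
    \<open>A\<close>, so both must lie in the domain of \<open>h\<close>.\<close>
  have \<tau>: "\<tau> A \<subseteq> Z" if "A \<subseteq> Z" for A
    using derivative_space.closed[OF Z that] .
  show ?thesis
  proof (rule that[OF k]; intro allI impI ballI)
    fix A y assume "A \<subseteq> Z" "y \<in> Y"
    then have "Inl -` (h ` A) \<inter> Y = {y\<in>Y. ?k (Inl y) \<in> A}"
      using meml[OF \<open>A \<subseteq> Z\<close>] by blast
    then show "?k (Inl y) \<in> \<tau> A \<longleftrightarrow> y \<in> \<sigma> {y\<in>Y. ?k (Inl y) \<in> A}"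
      using meml[OF \<tau>, of A y] im[of A] \<open>A \<subseteq> Z\<close> \<open>y \<in> Y\<close> by auto
  next
    fix A x assume "A \<subseteq> Z" "x \<in> X"
    then have "Inr -` (h ` A) \<inter> X = {x\<in>X. ?k (Inr x) \<in> A}"
      using memr[OF \<open>A \<subseteq> Z\<close>] by blast
    then show "?k (Inr x) \<in> \<tau> A \<longleftrightarrow> x \<in> \<rho> {x\<in>X. ?k (Inr x) \<in> A}"
      using memr[OF \<tau>, of A x] im[of A] \<open>A \<subseteq> Z\<close> \<open>x \<in> X\<close> by auto
  qed
qed

lemma space_power_Suc:
  assumes pow: "space_power n X \<rho> Y \<sigma> g"
    and iso: "space_iso (Z, \<tau>) (space_sum (Y, \<sigma>) (X, \<rho>))"
    and Z: "derivative_space Z \<tau>"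
  obtains g' where "space_power (Suc n) X \<rho> Z \<tau> g'"
proof -
  obtain k where k: "bij_betw k (Y <+> X) Z"
    and kl: "\<forall>A\<subseteq>Z. \<forall>y\<in>Y. k (Inl y) \<in> \<tau> A \<longleftrightarrow> y \<in> \<sigma> {y\<in>Y. k (Inl y) \<in> A}"
    and kr: "\<forall>A\<subseteq>Z. \<forall>x\<in>X. k (Inr x) \<in> \<tau> A \<longleftrightarrow> x \<in> \<rho> {x\<in>X. k (Inr x) \<in> A}"
    by (rule space_iso_sum_pointwise[OF iso Z]) blast
  have g: "bij_betw g (X \<times> {..<n}) Y"
    and \<sigma>: "\<And>A x i. A \<subseteq> Y \<Longrightarrow> x \<in> X \<Longrightarrow> i < n \<Longrightarrow>
      g (x, i) \<in> \<sigma> A \<longleftrightarrow> x \<in> \<rho> {z\<in>X. g (z, i) \<in> A}"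
    using pow by (auto simp: space_power_def)
  have gY: "g (x, i) \<in> Y" if "x \<in> X" "i < n" for x i
    using g that by (auto simp: bij_betw_def)
  \<comment> \<open>Copies below \<open>n\<close> are those of \<open>Y\<close>; the new right
    summand becomes copy \<open>n\<close>.\<close>
  define s where "s = (\<lambda>(x, i). if i < n then Inl (g (x, i)) else Inr x)"
  have "inj_on s (X \<times> {..<Suc n})"
    using inj_on_eq_iff[OF bij_betw_imp_inj_on[OF g]]
    by (auto simp: s_def inj_on_def less_Suc_eq split: if_splits)
  moreover have "s ` (X \<times> {..<Suc n}) = Y <+> X"
  proof
    show "s ` (X \<times> {..<Suc n}) \<subseteq> Y <+> X"
      by (auto simp: s_def gY)
    have "Inl y \<in> s ` (X \<times> {..<Suc n})" if y: "y \<in> Y" for y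
    proof -
      obtain x i where "x \<in> X" "i < n" "y = g (x, i)"
        using g y by (auto simp: bij_betw_def)
      then show ?thesis
        by (intro image_eqI[of _ _ "(x, i)"]) (auto simp: s_def)
    qed
    moreover have "Inr x \<in> s ` (X \<times> {..<Suc n})" if "x \<in> X" for x
      using that by (intro image_eqI[of _ _ "(x, n)"]) (auto simp: s_def)
    ultimately show "Y <+> X \<subseteq> s ` (X \<times> {..<Suc n})"
      by auto
  qed
  ultimately have "bij_betw (k \<circ> s) (X \<times> {..<Suc n}) Z"
    using k by (intro bij_betw_trans[of s]) (simp_all add: bij_betw_def)
  moreover have "(k \<circ> s) (x, i) \<in> \<tau> A \<longleftrightarrow> x \<in> \<rho> {z\<in>X. (k \<circ> s) (z, i) \<in> A}"
    if A: "A \<subseteq> Z" and x: "x \<in> X" and i: "i < Suc n" for A x i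
  proof (cases "i < n")
    case True
    have eq: "{z\<in>X. g (z, i) \<in> {y\<in>Y. k (Inl y) \<in> A}} = {z\<in>X. k (Inl (g (z, i))) \<in> A}"
      using gY[OF _ True] by auto
    have "k (Inl (g (x, i))) \<in> \<tau> A \<longleftrightarrow> x \<in> \<rho> {z\<in>X. g (z, i) \<in> {y\<in>Y. k (Inl y) \<in> A}}"
      using kl[rule_format, OF A gY[OF x True]] \<sigma>[OF _ x True, of "{y\<in>Y. k (Inl y) \<in> A}"] by simp
    then show ?thesis
      unfolding eq using True by (simp add: s_def)
  next
    case False
    then show ?thesis
      using kr[rule_format, OF A x] by (simp add: s_def)
  qed
  ultimately show ?thesis
    using that unfolding space_power_def by blast
qed

text \<open>Sums are binary, so copies are added one at a time. The induction starts at one copy,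
  since the empty space need not belong to \<open>\<Omega>\<close>.\<close>

lemma closed_under_sums_power:
  assumes der: "\<forall>(X, \<rho>)\<in>\<Omega>. derivative_space X \<rho>"
    and sums: "closed_under_sums \<Omega>"
    and X: "(X, \<rho>) \<in> \<Omega>"
  shows "\<exists>Y \<sigma> g. (Y, \<sigma>) \<in> \<Omega> \<and> space_power (Suc n) X \<rho> Y \<sigma> g"
proof (induction n)
  case 0
  interpret derivative_space X \<rho> using der X by blast
  have "space_power (Suc 0) X \<rho> X \<rho> fst"
    by (auto simp: space_power_def bij_betw_def inj_on_def image_iff Int_absorb1 Collect_conj_eq)
  then show ?case using X by blast
next
  case (Suc n)
  then obtain Y \<sigma> g where Y: "(Y, \<sigma>) \<in> \<Omega>" and g: "space_power (Suc n) X \<rho> Y \<sigma> g"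
    by blast
  from sums Y X obtain Z \<tau>
    where Z: "(Z, \<tau>) \<in> \<Omega>" and iso: "space_iso (Z, \<tau>) (space_sum (Y, \<sigma>) (X, \<rho>))"
    unfolding closed_under_sums_def by (metis surj_pair)
  have "derivative_space Z \<tau>"
    using der Z by blast
  from space_power_Suc[OF g iso this] Z show ?case
    by blast
qed

section \<open>Cyclic shift of the copies\<close>

lemma cyclic_shift_bij:
  assumes "0 < n"
  shows "bij_betw (\<lambda>i. Suc i mod n) {..<n} {..<n}"
proof -
  have "inj_on (\<lambda>i. Suc i mod n) {..<n}"
    by (auto simp: inj_on_def mod_Suc split: if_splits)
  moreover have "(\<lambda>i. Suc i mod n) ` {..<n} \<subseteq> {..<n}"
    using assms by auto
  ultimately show ?thesis
    by (simp add: bij_betw_def endo_inj_surj)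
qed

text \<open>On every copy \<open>\<tau>\<close> acts as the same \<open>\<rho>\<close>, so permuting
  the copies commutes with it.\<close>

lemma space_power_cyclic_shift:
  assumes pow: "space_power n X \<rho> Y \<tau> g" and "0 < n" and Y: "derivative_space Y \<tau>"
  obtains f where "invertible_system Y \<tau> f"
    and "\<And>x i. x \<in> X \<Longrightarrow> i < n \<Longrightarrow> f (g (x, i)) = g (x, Suc i mod n)"
proof -
  interpret derivative_space Y \<tau> by fact
  have g: "bij_betw g (X \<times> {..<n}) Y"
    and \<tau>: "\<And>A x i. A \<subseteq> Y \<Longrightarrow> x \<in> X \<Longrightarrow> i < n \<Longrightarrow>
      g (x, i) \<in> \<tau> A \<longleftrightarrow> x \<in> \<rho> {z\<in>X. g (z, i) \<in> A}"
    using pow by (auto simp: space_power_def)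
  have gY: "g (x, i) \<in> Y" if "x \<in> X" "i < n" for x i
    using g that by (auto simp: bij_betw_def)
  define f where "f = g \<circ> map_prod id (\<lambda>i. Suc i mod n) \<circ> inv_into (X \<times> {..<n}) g"
  have fg: "f (g (x, i)) = g (x, Suc i mod n)" if "x \<in> X" "i < n" for x i
    using bij_betw_inv_into_left[OF g, of "(x, i)"] that by (simp add: f_def)
  have "bij_betw (map_prod id (\<lambda>i. Suc i mod n)) (X \<times> {..<n}) (X \<times> {..<n})"
    using cyclic_shift_bij[OF \<open>0 < n\<close>] bij_betw_id[of X] by (rule_tac bij_betw_map_prod)
  then have "bij_betw f Y Y"
    unfolding f_def using g bij_betw_inv_into[OF g] by (blast intro: bij_betw_trans)
  moreover have "\<tau> (f -` A \<inter> Y) = f -` \<tau> A \<inter> Y" if A: "A \<subseteq> Y" for A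
  proof -
    have "y \<in> \<tau> (f -` A \<inter> Y) \<longleftrightarrow> f y \<in> \<tau> A" if "y \<in> Y" for y
    proof -
      obtain x i where x: "x \<in> X" and i: "i < n" and y: "y = g (x, i)"
        using g \<open>y \<in> Y\<close> by (auto simp: bij_betw_def)
      have i': "Suc i mod n < n"
        using \<open>0 < n\<close> by simp
      \<comment> \<open>The slice of the preimage in copy \<open>i\<close> is the slice of
        \<open>A\<close> in the next copy.\<close>
      have "{z\<in>X. g (z, i) \<in> f -` A \<inter> Y} = {z\<in>X. g (z, Suc i mod n) \<in> A}"
        using fg i gY by auto
      then show ?thesis
        using \<tau>[OF _ x i, of "f -` A \<inter> Y"] \<tau>[OF A x i'] by (simp add: y fg[OF x i])
    qed
    moreover have "\<tau> (f -` A \<inter> Y) \<subseteq> Y"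
      by (rule closed) simp
    ultimately show ?thesis
      by blast
  qed
  ultimately have "invertible_system Y \<tau> f"
    by unfold_locales
  then show ?thesis
    using fg that by blast
qed

section \<open>Evaluation on a power\<close>

text \<open>The bound \<open>i + size \<phi> < n\<close> keeps the evaluation of \<open>\<phi>\<close> from wrapping around the cycle.\<close>

lemma sem_space_power:
  assumes pow: "space_power n X \<rho> Y \<tau> g"
    and X: "derivative_space X \<rho>" and Y: "derivative_space Y \<tau>"
    and f: "\<And>x i. x \<in> X \<Longrightarrow> i < n \<Longrightarrow> f (g (x, i)) = g (x, Suc i mod n)"
    and \<nu>: "\<And>p. \<nu> p \<subseteq> X" and \<nu>': "\<And>p. \<nu>' p \<subseteq> Y"
    and var: "\<And>p x i. x \<in> X \<Longrightarrow> i < n \<Longrightarrow> g (x, i) \<in> \<nu>' p \<longleftrightarrow> x \<in> \<nu> (e (p, i))"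
  shows "x \<in> X \<Longrightarrow> i + size \<phi> < n \<Longrightarrow>
    g (x, i) \<in> sem Y \<tau> f \<nu>' \<phi> \<longleftrightarrow> x \<in> sem X \<rho> id \<nu> (push_next e i \<phi>)"
proof (induction \<phi> arbitrary: x i)
  case (Var p)
  then show ?case by (simp add: var)
next
  case (And \<phi> \<psi>)
  then show ?case by simp
next
  case (Neg \<phi>)
  have "g (x, i) \<in> Y"
    using pow Neg.prems by (auto simp: space_power_def bij_betw_def)
  then show ?case using Neg by simp
next
  case (Dia \<phi>)
  have subX: "sem X \<rho> id \<nu> \<psi> \<subseteq> X" for \<psi>
    using \<nu> by (induction \<psi>) (auto dest: derivative_space.closed[OF X])
  have subY: "sem Y \<tau> f \<nu>' \<psi> \<subseteq> Y" for \<psi>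
    using \<nu>' by (induction \<psi>) (auto dest: derivative_space.closed[OF Y])
  \<comment> \<open>On copy \<open>i\<close>, \<open>\<tau>\<close> depends only on this slice,
    which the induction hypothesis at the same \<open>i\<close> identifies.\<close>
  have "{z\<in>X. g (z, i) \<in> sem Y \<tau> f \<nu>' \<phi>} = sem X \<rho> id \<nu> (push_next e i \<phi>)"
    using Dia.IH[of _ i] \<open>i + size (Dia \<phi>) < n\<close> subX by fastforce
  then show ?case
    using pow Dia.prems subY[of \<phi>]
    by (simp add: space_power_def del: id_apply)
next
  case (Next \<phi>)
  have "g (x, i) \<in> Y"
    using pow Next.prems by (auto simp: space_power_def bij_betw_def)
  \<comment> \<open>The size bound gives \<open>Suc i < n\<close>, so the remainder is
    \<open>Suc i\<close>, the index that \<open>push_next\<close> uses.\<close>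
  then show ?case
    using Next by (simp add: f)
qed

section \<open>Transfer of completeness\<close>

theorem theorem8p5:
  fixes \<Lambda> :: "'v fm set" and \<Omega> :: "'a space set"
  assumes "infinite (UNIV :: 'v set)"
    and "normal_logic \<Lambda>"
    and "\<forall>(X, \<rho>)\<in>\<Omega>. derivative_space X \<rho>"
    and "complete_for_spaces \<Lambda> \<Omega>"
    and "closed_under_sums \<Omega>"
  shows "complete_for_systems (logic_H \<Lambda>) (invertible_systems_on \<Omega>)"
  unfolding complete_for_systems_def
proof (intro allI impI)
  fix \<phi> :: "'v fm"
  assume valid: "\<forall>(X, \<rho>, f)\<in>invertible_systems_on \<Omega>. valid_system X \<rho> f \<phi>"
  \<comment> \<open>An infinite set has as many elements as its product with the natural
    numbers.\<close>
  obtain e :: "'v \<times> nat \<Rightarrow> 'v" where e: "inj e"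
    using card_of_Times_infinite_simps(1)[OF assms(1) UNIV_not_empty
        infinite_iff_card_of_nat[THEN iffD1, OF assms(1)]]
    unfolding card_of_ordIso[symmetric] by (auto simp: bij_betw_def)
  have "push_next e 0 \<phi> \<in> \<Lambda>"
  proof -
    have "valid_space X \<rho> (push_next e 0 \<phi>)" if X: "(X, \<rho>) \<in> \<Omega>" for X \<rho>
      unfolding valid_space_def valid_system_def
    proof (intro allI impI)
      fix \<nu> :: "'v \<Rightarrow> 'a set"
      assume \<nu>: "\<forall>p. \<nu> p \<subseteq> X"
      interpret derivative_space X \<rho> using assms(3) X by blast
      \<comment> \<open>Evaluation starts in copy \<open>0\<close>, so
        \<open>Suc (size \<phi>)\<close> copies meet the strict bound
        \<open>0 + size \<phi> < n\<close>.\<close>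
      obtain Y \<tau> g where Y: "(Y, \<tau>) \<in> \<Omega>" and g: "space_power (Suc (size \<phi>)) X \<rho> Y \<tau> g"
        using closed_under_sums_power[OF assms(3,5) X] by blast
      have dY: "derivative_space Y \<tau>"
        using assms(3) Y by blast
      obtain f where inv: "invertible_system Y \<tau> f"
        and f: "\<And>x i. x \<in> X \<Longrightarrow> i < Suc (size \<phi>) \<Longrightarrow>
          f (g (x, i)) = g (x, Suc i mod Suc (size \<phi>))"
        using space_power_cyclic_shift[OF g _ dY] by auto
      have bij: "bij_betw g (X \<times> {..<Suc (size \<phi>)}) Y"
        using g by (simp add: space_power_def)
      define \<nu>' where "\<nu>' p = g ` {(x, i). x \<in> \<nu> (e (p, i)) \<and> i < Suc (size \<phi>)}" for p
      have \<nu>': "\<nu>' p \<subseteq> Y" for p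
        using bij \<nu> by (fastforce simp: \<nu>'_def bij_betw_def)
      have "g (x, i) \<in> \<nu>' p \<longleftrightarrow> x \<in> \<nu> (e (p, i))" if "x \<in> X" "i < Suc (size \<phi>)" for p x i
        unfolding \<nu>'_def
        by (subst inj_on_image_mem_iff[OF bij_betw_imp_inj_on[OF bij]]) (use that \<nu> in auto)
      from sem_space_power[OF g derivative_space_axioms dY f _ \<nu>' this, of _ 0 \<phi>] \<nu>
      have "g (x, 0) \<in> sem Y \<tau> f \<nu>' \<phi> \<longleftrightarrow> x \<in> sem X \<rho> id \<nu> (push_next e 0 \<phi>)" if "x \<in> X" for x
        using that by simp
      moreover have "sem Y \<tau> f \<nu>' \<phi> = Y"
        using valid Y inv \<nu>' by (auto simp: invertible_systems_on_def valid_system_def)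
      moreover have "g (x, 0) \<in> Y" if "x \<in> X" for x
        using bij that by (auto simp: bij_betw_def)
      moreover have "sem X \<rho> id \<nu> \<psi> \<subseteq> X" for \<psi>
        using \<nu> by (induction \<psi>) (auto dest: closed)
      ultimately show "sem X \<rho> id \<nu> (push_next e 0 \<phi>) = X"
        by blast
    qed
    then show ?thesis
      by (intro complete_for_spacesD[OF assms(4)] next_free_push_next)
  qed
  then have "subst \<sigma> (push_next e 0 \<phi>) \<in> logic_H \<Lambda>" for \<sigma>
    by (rule logic_H.inst)
  \<comment> \<open>As \<open>e\<close> is injective, \<open>inv e\<close> recovers
    \<open>(p, i)\<close> from the variable \<open>e (p, i)\<close>.\<close>
  moreover define \<sigma> where "\<sigma> = (\<lambda>(p, i). (Next ^^ i) (Var p)) \<circ> inv e"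
  moreover have "Iff \<phi> (subst \<sigma> (push_next e 0 \<phi>)) \<in> logic_H \<Lambda>"
    using logic_H_push_next[OF logic_H_dia_cong[OF assms(1,3,4)], of \<sigma> e 0 \<phi>] e
    by (simp add: \<sigma>_def)
  ultimately have "subst \<sigma> (push_next e 0 \<phi>) \<in> logic_H \<Lambda>"
    and "Iff \<phi> (subst \<sigma> (push_next e 0 \<phi>)) \<in> logic_H \<Lambda>"
    by blast+
  then show "\<phi> \<in> logic_H \<Lambda>"
    by (rule logic_H_taut_mp2) (auto simp: tautology_def)
qed

end
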